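(* Let $\mathcal{FR}\subset C(S^1)$ be the operator system of functions on the unit circle $S^1\subset\mathbb{C}$ of the form $a(z)=a_{-1}\overline{z}+a_0+a_1 z$ with $a_{-1},a_0,a_1\in\mathbb{C}$. Then: (1) the sign of a nowhere-vanishing real-valued function induces bijections $\pi_0(\mathcal{FR}_h^\times)\cong\{\pm1\}$ and $\pi_0(C(S^1)_h^\times)\cong\{\pm 1\}$; (2) the winding number around $0$ induces a bijection $\pi_0(\mathcal{FR}^\times)\cong\{-1,0,1\}$, whereas it induces a bijection $\pi_0(C(S^1)^\times)\cong\mathbb{Z}$.
   Context: $C(S^1)$ is the $C^*$-algebra of continuous complex-valued functions on $S^1$ with the sup norm. $\mathcal{FR}^\times$ (resp. $C(S^1)^\times$) denotes the set of elements of $\mathcal{FR}$ (resp. $C(S^1)$) that are invertible in $C(S^1)$, i.e. nowhere vanishing on $S^1$; $\mathcal{FR}_h^\times$ and $C(S^1)_h^\times$ denote the subsets of self-adjoint (i.e. real-valued) elements. All these sets carry the norm topology, and $\pi_0$ denotes the set of path components. (Invertibility is taken in $C(S^1)$ because $C(S^1)$ is the $C^*$-envelope of $\mathcal{FR}$.) *)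

theory Defs
  imports "HOL-Complex_Analysis.Complex_Analysis"
begin

abbreviation S1 :: "complex set"
  where "S1 \<equiv> sphere 0 1"

text \<open>
  \<open>cfunspace\<close> is the library's metric space of bounded continuous functions with the sup metric.
  Its elements are extensional, i.e. equal to \<open>undefined\<close> off the circle, so that they
  correspond bijectively to the continuous functions on the circle; see \<open>mspace_CS1\<close> and
  \<open>mdist_CS1\<close> below.
\<close>
definition CS1 :: "(complex \<Rightarrow> complex) metric"
  where "CS1 = cfunspace (top_of_set S1) euclidean_metric"

definition FR :: "(complex \<Rightarrow> complex) set"
  where "FR = {restrict (\<lambda>z. a' * cnj z + a0 + a1 * z) S1 | a' a0 a1. True}"

definition invertibles :: "(complex \<Rightarrow> complex) set \<Rightarrow> (complex \<Rightarrow> complex) set"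
  where "invertibles A = {a \<in> A. \<exists>b \<in> mspace CS1. \<forall>z\<in>S1. a z * b z = 1}"

definition self_adjoints :: "(complex \<Rightarrow> complex) set \<Rightarrow> (complex \<Rightarrow> complex) set"
  where "self_adjoints A = {a \<in> A. \<forall>z\<in>S1. cnj (a z) = a z}"

definition norm_topology_on :: "(complex \<Rightarrow> complex) set \<Rightarrow> (complex \<Rightarrow> complex) topology"
  where "norm_topology_on A = subtopology (mtopology_of CS1) A"

definition induces_bij_on_pi0 :: "('a \<Rightarrow> 'b) \<Rightarrow> 'a topology \<Rightarrow> 'b set \<Rightarrow> bool"
  where "induces_bij_on_pi0 f X T \<longleftrightarrow>
    (\<exists>F. (\<forall>C \<in> path_components_of X. \<forall>a \<in> C. F C = f a) \<and> bij_betw F (path_components_of X) T)"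

text \<open>The common sign of all values; well defined by \<open>sgn_eq_function_sign\<close> below.\<close>
definition function_sign :: "(complex \<Rightarrow> complex) \<Rightarrow> real"
  where "function_sign a = (THE s. \<forall>z\<in>S1. sgn (Re (a z)) = s)"

text \<open>The library's winding number is complex-valued, with values in \<open>\<int>\<close> on closed paths.\<close>
definition winding_about_0 :: "(complex \<Rightarrow> complex) \<Rightarrow> complex"
  where "winding_about_0 a = winding_number (a \<circ> circlepath 0 1) 0"

lemma mspace_CS1: "mspace CS1 = {a \<in> extensional S1. continuous_on S1 a}"
proof -
  have "bounded (a ` S1)" if "continuous_on S1 a" for a :: "complex \<Rightarrow> complex"
    using compact_continuous_image[OF that] by (simp add: compact_imp_bounded)
  then show ?thesis
    by (auto simp: CS1_def)
qed

lemma mdist_CS1: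
  assumes "a \<in> mspace CS1" "b \<in> mspace CS1"
  shows "mdist CS1 a b = (SUP z\<in>S1. norm (a z - b z))"
proof -
  have "S1 \<noteq> {}" by simp
  with assms show ?thesis
    by (auto simp: CS1_def cfunspace_def Met_TC.fdist_def Met_TC.fspace_def dist_norm)
qed

lemma FR_subset_CS1: "FR \<subseteq> mspace CS1"
proof -
  have "continuous_on S1 (restrict (\<lambda>z. a' * cnj z + a0 + a1 * z) S1)" for a' a0 a1
    by (rule continuous_on_eq[of S1 "\<lambda>z. a' * cnj z + a0 + a1 * z"]) (auto intro!: continuous_intros)
  then show ?thesis
    by (auto simp: FR_def mspace_CS1)
qed

lemma invertibles_iff:
  assumes "A \<subseteq> mspace CS1"
  shows "invertibles A = {a \<in> A. \<forall>z\<in>S1. a z \<noteq> 0}"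
proof -
  have "\<exists>b \<in> mspace CS1. \<forall>z\<in>S1. a z * b z = 1" if "a \<in> A" "\<forall>z\<in>S1. a z \<noteq> 0" for a
  proof
    have "continuous_on S1 (\<lambda>z. inverse (a z))"
      using that assms by (auto simp: mspace_CS1 intro!: continuous_on_inverse)
    then have "continuous_on S1 (restrict (\<lambda>z. inverse (a z)) S1)"
      by (rule continuous_on_eq) simp
    then show "restrict (\<lambda>z. inverse (a z)) S1 \<in> mspace CS1"
      by (simp add: mspace_CS1)
    show "\<forall>z\<in>S1. a z * restrict (\<lambda>z. inverse (a z)) S1 z = 1"
      using that by simp
  qed
  then show ?thesis
    unfolding invertibles_def by force
qed

lemma sgn_eq_function_sign:
  assumes a: "a \<in> self_adjoints (invertibles (mspace CS1))" and z: "z \<in> S1"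
  shows "sgn (Re (a z)) = function_sign a"
proof -
  have cont: "continuous_on S1 (\<lambda>z. Re (a z))"
    using a by (auto simp: self_adjoints_def invertibles_def mspace_CS1 intro!: continuous_intros)
  have nz: "Re (a w) \<noteq> 0" if "w \<in> S1" for w
    using a that unfolding self_adjoints_def invertibles_iff[OF subset_refl]
    by (auto simp: complex_eq_iff)
  have conn: "connected ((\<lambda>z. Re (a z)) ` S1)"
    using connected_continuous_image[OF cont] connected_sphere[of "0::complex" 1] by simp
  have iv: "\<not> (Re (a v) < 0 \<and> 0 < Re (a w))" if "v \<in> S1" "w \<in> S1" for v w
  proof
    assume "Re (a v) < 0 \<and> 0 < Re (a w)"
    moreover have "Re (a v) \<in> (\<lambda>z. Re (a z)) ` S1" "Re (a w) \<in> (\<lambda>z. Re (a z)) ` S1"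
      using that by (blast intro: imageI)+
    ultimately have "0 \<in> (\<lambda>z. Re (a z)) ` S1"
      using connectedD_interval[OF conn, of "Re (a v)" "Re (a w)" 0] by linarith
    then obtain u where "u \<in> S1" "0 = Re (a u)"
      by (rule imageE)
    with nz[of u] show False by simp
  qed
  have eq: "sgn (Re (a w)) = sgn (Re (a z))" if "w \<in> S1" for w
    using nz[OF that] nz[OF z] iv[OF that z] iv[OF z that] by (simp add: sgn_if)
  show ?thesis
    unfolding function_sign_def
  proof (rule the_equality[symmetric])
    show "\<forall>w\<in>S1. sgn (Re (a w)) = sgn (Re (a z))"
      using eq by blast
    show "s = sgn (Re (a z))" if "\<forall>w\<in>S1. sgn (Re (a w)) = s" for s
      using bspec[OF that z] by (rule sym)
  qed
qed

end

theory Submission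
  imports Defs
begin

text \<open>
  Both the sign and the winding number are unchanged under perturbations \<open>b\<close> of \<open>a\<close> with
  \<open>\<bar>b - a\<bar> < \<bar>a\<bar>\<close>, hence are locally constant on the invertible elements and constant on path
  components. Conversely, segments join real-valued elements of equal sign, and loops in
  \<open>\<complex> - {0}\<close> of equal winding number are homotopic. To stay within \<open>FR\<close>, factor
  \<open>z a(z) = (\<alpha> + \<beta> z) (\<gamma> + \<delta> z)\<close>; a factor has no zero on the circle iff
  \<open>\<bar>\<alpha>\<bar> \<noteq> \<bar>\<beta>\<bar>\<close>, and shrinking its smaller coefficient to \<open>0\<close> deforms it to \<open>1\<close> or \<open>z\<close>. So \<open>a\<close> is
  joined inside \<open>FR\<close> to one of \<open>z\<^sup>-\<^sup>1\<close>, \<open>1\<close>, \<open>z\<close>.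
\<close>

section \<open>Bijections on path components from chosen representatives\<close>

text \<open>Reduces each claim to three checks: \<open>f\<close> is invariant along paths, every
  value \<open>k\<close> is realized by a model element \<open>r k\<close>, and every element is
  joined to some model. Models carry different values, so they separate the components, and the
  index of the model joined to \<open>a\<close> is forced to be \<open>f a\<close>.\<close>

lemma induces_bij_on_pi0_representatives:
  assumes inv: "\<And>a b. path_component_of X a b \<Longrightarrow> f a = f b"
    and r: "\<And>k. k \<in> T \<Longrightarrow> r k \<in> topspace X" "\<And>k. k \<in> T \<Longrightarrow> f (r k) = k"
    and rep: "\<And>a. a \<in> topspace X \<Longrightarrow> \<exists>k\<in>T. path_component_of X a (r k)"
  shows "induces_bij_on_pi0 f X T"
proof -
  \<comment> \<open>The chosen element is immaterial: any two members of a component are joined by a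
    path, and \<open>inv\<close> makes their values agree.\<close>
  define F where "F C = f (SOME a. a \<in> C)" for C
  have F: "F C = f a" if C: "C \<in> path_components_of X" and a: "a \<in> C" for C a
  proof -
    have "(SOME a. a \<in> C) \<in> C"
      using a by (rule someI)
    with C a have "path_component_of X (SOME a. a \<in> C) a"
      unfolding path_components_of_def
      by (metis (no_types, lifting) imageE mem_Collect_eq path_component_of_sym path_component_of_trans)
    then show ?thesis
      unfolding F_def by (rule inv)
  qed
  have F': "F (path_component_of_set X a) = f a" if "a \<in> topspace X" for a
    using that by (intro F) (auto simp: path_components_of_def path_component_of_refl)
  have "bij_betw F (path_components_of X) T"
    unfolding bij_betw_def
  proof
    show "inj_on F (path_components_of X)"
    proof (rule inj_onI)
      fix C D assume "C \<in> path_components_of X" "D \<in> path_components_of X" and eq: "F C = F D"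
      then obtain a b where ab: "a \<in> topspace X" "b \<in> topspace X"
        and C: "C = path_component_of_set X a" and D: "D = path_component_of_set X b"
        by (auto simp: path_components_of_def)
      obtain k l where k: "k \<in> T" "path_component_of X a (r k)"
        and l: "l \<in> T" "path_component_of X b (r l)"
        using rep ab by blast
      \<comment> \<open>By invariance and \<open>f (r k) = k\<close>, the indices are
        \<open>f a\<close> and \<open>f b\<close>, which are the values of \<open>F\<close> at
        \<open>C\<close> and \<open>D\<close>.\<close>
      have "k = l"
        using eq inv[OF k(2)] inv[OF l(2)] r(2) k(1) l(1) ab by (simp add: C D F')
      with k l show "C = D"
        unfolding C D by (metis path_component_of_equiv)
    qed
    show "F ` path_components_of X = T"
    proof
      show "F ` path_components_of X \<subseteq> T"
      proof clarify
        fix C assume "C \<in> path_components_of X"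
        then obtain a where a: "a \<in> topspace X" "C = path_component_of_set X a"
          by (auto simp: path_components_of_def)
        then obtain k where "k \<in> T" "path_component_of X a (r k)"
          using rep by blast
        then show "F C \<in> T"
          using a F' inv r by metis
      qed
      show "T \<subseteq> F ` path_components_of X"
      proof
        fix k assume "k \<in> T"
        then have "k = F (path_component_of_set X (r k))"
          by (simp add: F' r)
        with \<open>k \<in> T\<close> r(1) show "k \<in> F ` path_components_of X"
          unfolding path_components_of_def by blast
      qed
    qed
  qed
  with F show ?thesis
    unfolding induces_bij_on_pi0_def by blast
qed

section \<open>Paths and locally constant invariants in the norm topology\<close>

lemma topspace_norm_topology_on:
  assumes "A \<subseteq> mspace CS1"
  shows "topspace (norm_topology_on A) = A"
  using assms by (auto simp: norm_topology_on_def)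

lemma invertibles_subset: "invertibles A \<subseteq> A"
  by (auto simp: invertibles_def)

lemma invertibles_mono: "A \<subseteq> B \<Longrightarrow> invertibles A \<subseteq> invertibles B"
  by (auto simp: invertibles_def)

lemma self_adjoints_subset: "self_adjoints A \<subseteq> A"
  by (auto simp: self_adjoints_def)

lemma norm_diff_le_mdist_CS1:
  assumes ab: "a \<in> mspace CS1" "b \<in> mspace CS1" and z: "z \<in> S1"
  shows "norm (a z - b z) \<le> mdist CS1 a b"
proof -
  have "continuous_on S1 (\<lambda>z. norm (a z - b z))"
    using ab by (auto simp: mspace_CS1 intro!: continuous_intros)
  then have "bdd_above ((\<lambda>z. norm (a z - b z)) ` S1)"
    by (intro bounded_imp_bdd_above compact_imp_bounded compact_continuous_image) auto
  then show ?thesis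
    unfolding mdist_CS1[OF ab] using z by (rule cSUP_upper2) simp
qed

text \<open>Joint continuity on the compact set \<open>{0..1} \<times> S1\<close> is uniform, so
  nearby times give functions that are close uniformly in \<open>z\<close>. Hence a homotopy is a
  path for the sup metric, and the remaining work is to keep each stage in \<open>A\<close>.\<close>

lemma path_component_of_homotopy:
  fixes h :: "real \<Rightarrow> complex \<Rightarrow> complex"
  assumes A: "A \<subseteq> mspace CS1"
    and cont: "continuous_on ({0..1} \<times> S1) (\<lambda>(t, z). h t z)"
    and hA: "\<And>t. t \<in> {0..1} \<Longrightarrow> restrict (h t) S1 \<in> A"
  shows "path_component_of (norm_topology_on A) (restrict (h 0) S1) (restrict (h 1) S1)"
proof -
  define g where "g t = restrict (h t) S1" for t
  have gM: "g t \<in> mspace CS1" if "t \<in> {0..1}" for t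
    using hA[OF that] A unfolding g_def by blast
  have uc: "uniformly_continuous_on ({0..1} \<times> S1) (\<lambda>(t, z). h t z)"
    by (intro compact_uniformly_continuous cont compact_Times) auto
  interpret CS1: Metric_space "mspace CS1" "mdist CS1" by simp
  have "continuous_map (top_of_set {0..1}) CS1.mtopology g"
    unfolding CS1.continuous_map_to_metric
  proof (intro ballI allI impI)
    fix t :: real and e :: real assume "t \<in> topspace (top_of_set {0..1})" and e: "e > 0"
    then have t: "t \<in> {0..1}" by simp
    \<comment> \<open>Half of \<open>e\<close> is used because passing to the supremum only
      preserves the non-strict inequality.\<close>
    obtain d where d: "d > 0" "\<And>x y. x \<in> {0..1} \<times> S1 \<Longrightarrow> y \<in> {0..1} \<times> S1 \<Longrightarrow> dist y x < d \<Longrightarrow>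
        dist ((\<lambda>(t, z). h t z) y) ((\<lambda>(t, z). h t z) x) < e / 2"
      using uc e unfolding uniformly_continuous_on_def by (metis half_gt_zero)
    show "\<exists>U. openin (top_of_set {0..1}) U \<and> t \<in> U \<and> (\<forall>s\<in>U. g s \<in> CS1.mball (g t) e)"
    proof (intro exI conjI ballI)
      show "openin (top_of_set {0..1}) ({0..1} \<inter> ball t d)" by auto
      show "t \<in> {0..1} \<inter> ball t d" using t d by auto
      fix s assume "s \<in> {0..1} \<inter> ball t d"
      then have s: "s \<in> {0..1}" "dist t s < d" by auto
      have "mdist CS1 (g t) (g s) \<le> e / 2"
        unfolding mdist_CS1[OF gM[OF t] gM[OF s(1)]]
      proof (rule cSUP_least)
        fix z :: complex assume z: "z \<in> S1"
        have "dist (h t z) (h s z) < e / 2"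
          using d(2)[of "(s, z)" "(t, z)"] s t z by (simp add: dist_Pair_Pair)
        then show "norm (g t z - g s z) \<le> e / 2"
          using z by (simp add: g_def dist_norm)
      qed simp
      then show "g s \<in> CS1.mball (g t) e"
        using e gM s t by (simp add: CS1.in_mball)
    qed
  qed
  then have "pathin (norm_topology_on A) g"
    unfolding pathin_def norm_topology_on_def mtopology_of_def
    using hA by (simp add: continuous_map_in_subtopology g_def image_subset_iff)
  then show ?thesis
    unfolding path_component_of_def g_def by blast
qed

text \<open>Serves both the sign and the winding number. By compactness of the circle,
  \<open>loc\<close> makes \<open>f\<close> constant on a sup-norm ball (within \<open>A\<close>)
  around each element.\<close>

lemma locally_constant_imp_path_component_invariant:
  assumes A: "A \<subseteq> invertibles (mspace CS1)"
    and loc: "\<And>a b. a \<in> A \<Longrightarrow> b \<in> A \<Longrightarrow> (\<And>z. z \<in> S1 \<Longrightarrow> norm (b z - a z) < norm (a z)) \<Longrightarrow> f a = f b"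
    and ab: "path_component_of (norm_topology_on A) a b"
  shows "f a = f b"
proof -
  interpret CS1: Metric_space "mspace CS1" "mdist CS1" by simp
  have AM: "A \<subseteq> mspace CS1"
    using A by (auto simp: invertibles_def)
  have nbhd: "\<exists>e>0. \<forall>b \<in> A. mdist CS1 a b < e \<longrightarrow> f b = f a" if a: "a \<in> A" for a
  proof -
    have "continuous_on S1 (\<lambda>z. norm (a z))"
      using a AM by (auto simp: mspace_CS1 intro!: continuous_intros)
    \<comment> \<open>The minimum of the modulus of \<open>a\<close> on the circle is positive and
      serves as the radius of the ball.\<close>
    then obtain w where w: "w \<in> S1" "\<And>z. z \<in> S1 \<Longrightarrow> norm (a w) \<le> norm (a z)"
      using continuous_attains_inf[of S1 "\<lambda>z. norm (a z)"] by auto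
    have "a w \<noteq> 0"
      using a A w invertibles_iff[OF subset_refl] by blast
    moreover have "f b = f a" if b: "b \<in> A" "mdist CS1 a b < norm (a w)" for b
    proof (rule sym, rule loc[OF a b(1)])
      fix z assume z: "z \<in> S1"
      have "norm (a z - b z) \<le> mdist CS1 a b"
        using a b AM z by (intro norm_diff_le_mdist_CS1) auto
      with w(2)[OF z] b(2) show "norm (b z - a z) < norm (a z)"
        by (simp add: norm_minus_commute)
    qed
    ultimately show ?thesis
      by (intro exI[of _ "norm (a w)"]) auto
  qed
  \<comment> \<open>Local constancy is continuity into a discrete space, whose path components are
    single points.\<close>
  have "continuous_map (norm_topology_on A) (discrete_topology UNIV) f"
    unfolding continuous_map_eq_topcontinuous_at topcontinuous_at_def topspace_norm_topology_on[OF AM]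
  proof (intro ballI allI impI conjI)
    fix a U assume a: "a \<in> A" and "openin (discrete_topology UNIV) U \<and> f a \<in> U"
    then have U: "f a \<in> U" by simp
    obtain e where e: "e > 0" "\<And>b. b \<in> A \<Longrightarrow> mdist CS1 a b < e \<Longrightarrow> f b = f a"
      using nbhd[OF a] by blast
    have "openin (norm_topology_on A) (CS1.mball a e \<inter> A)"
      unfolding norm_topology_on_def mtopology_of_def by (intro openin_subtopology_Int CS1.openin_mball)
    moreover have "a \<in> CS1.mball a e \<inter> A"
      using a AM e by auto
    moreover have "f b \<in> U" if "b \<in> CS1.mball a e \<inter> A" for b
      using that e(2)[of b] U by simp
    ultimately show "\<exists>V. openin (norm_topology_on A) V \<and> a \<in> V \<and> (\<forall>b\<in>V. f b \<in> U)"
      by blast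
  qed auto
  from path_component_of_continuous_image[OF this ab] show ?thesis
    by simp
qed

section \<open>The sign of self-adjoint invertible elements\<close>

text \<open>The sign can be read off at the single point 1, where both values are real and a change
  smaller than the modulus cannot cross 0.\<close>

lemma function_sign_near:
  assumes a: "a \<in> self_adjoints (invertibles (mspace CS1))"
    and b: "b \<in> self_adjoints (invertibles (mspace CS1))"
    and near: "\<And>z. z \<in> S1 \<Longrightarrow> norm (b z - a z) < norm (a z)"
  shows "function_sign a = function_sign b"
proof -
  have 1: "(1::complex) \<in> S1" by simp
  have "Im (a 1) = 0" "Im (b 1) = 0"
    using a b by (auto simp: self_adjoints_def complex_eq_iff)
  then have "\<bar>Re (b 1) - Re (a 1)\<bar> < \<bar>Re (a 1)\<bar>"
    using near[OF 1] by (simp add: cmod_eq_Re)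
  then have "sgn (Re (a 1)) = sgn (Re (b 1))"
    by (auto simp: sgn_if)
  then show ?thesis
    by (simp add: sgn_eq_function_sign[OF a 1] sgn_eq_function_sign[OF b 1])
qed

lemma FR_segment:
  fixes t :: real
  assumes "a \<in> FR" "b \<in> FR"
  shows "restrict (\<lambda>z. of_real (1 - t) * a z + of_real t * b z) S1 \<in> FR"
proof -
  obtain a' a0 a1 b' b0 b1 where
    "a = restrict (\<lambda>z. a' * cnj z + a0 + a1 * z) S1"
    "b = restrict (\<lambda>z. b' * cnj z + b0 + b1 * z) S1"
    using assms by (auto simp: FR_def)
  then have "restrict (\<lambda>z. of_real (1 - t) * a z + of_real t * b z) S1 =
      restrict (\<lambda>z. (of_real (1 - t) * a' + of_real t * b') * cnj z +
        (of_real (1 - t) * a0 + of_real t * b0) + (of_real (1 - t) * a1 + of_real t * b1) * z) S1"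
    by (auto simp: fun_eq_iff algebra_simps)
  then show ?thesis
    unfolding FR_def by blast
qed

lemma mspace_CS1_segment:
  fixes t :: real
  assumes "a \<in> mspace CS1" "b \<in> mspace CS1"
  shows "restrict (\<lambda>z. of_real (1 - t) * a z + of_real t * b z) S1 \<in> mspace CS1"
proof -
  have "continuous_on S1 (\<lambda>z. of_real (1 - t) * a z + of_real t * b z)"
    using assms by (auto simp: mspace_CS1 intro!: continuous_intros)
  then have "continuous_on S1 (restrict (\<lambda>z. of_real (1 - t) * a z + of_real t * b z) S1)"
    by (rule continuous_on_eq) simp
  then show ?thesis
    by (simp add: mspace_CS1)
qed

lemma const_in_FR: "restrict (\<lambda>z. c) S1 \<in> FR"
  unfolding FR_def by (force intro: exI[of _ 0])

lemma convex_combination_nonzero: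
  fixes x y t :: real
  assumes "x \<noteq> 0" "sgn y = sgn x" "t \<in> {0..1}"
  shows "(1 - t) * x + t * y \<noteq> 0"
proof (cases "x > 0")
  case True
  then have "y > 0" using assms by (auto simp: sgn_if split: if_splits)
  \<comment> \<open>\<open>convex_bound_lt\<close> bounds from above, so the positive case passes to
    \<open>-x\<close> and \<open>-y\<close>.\<close>
  with True show ?thesis
    using assms convex_bound_lt[of "-x" 0 "-y" "1 - t" t] by (simp add: algebra_simps)
next
  case False
  then have "x < 0" "y < 0" using assms by (auto simp: sgn_if split: if_splits)
  then show ?thesis
    using assms convex_bound_lt[of x 0 y "1 - t" t] by simp
qed

text \<open>Covers \<open>FR\<close> and all of \<open>mspace CS1\<close> at once: the argument
  needs only the constants as models and segments as paths.\<close>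

lemma induces_bij_on_pi0_function_sign:
  assumes A: "A \<subseteq> mspace CS1"
    and const: "\<And>c. restrict (\<lambda>z. c) S1 \<in> A"
    and segment: "\<And>a b t. a \<in> A \<Longrightarrow> b \<in> A \<Longrightarrow>
      restrict (\<lambda>z. of_real (1 - t) * a z + of_real t * b z) S1 \<in> A"
  shows "induces_bij_on_pi0 function_sign (norm_topology_on (self_adjoints (invertibles A))) {-1, 1}"
proof -
  let ?B = "self_adjoints (invertibles A)"
  let ?r = "\<lambda>s::real. restrict (\<lambda>z. of_real s) S1 :: complex \<Rightarrow> complex"
  have Beq: "?B = {a \<in> A. \<forall>z\<in>S1. a z \<noteq> 0 \<and> cnj (a z) = a z}"
    unfolding self_adjoints_def invertibles_iff[OF A] by blast
  have BM: "?B \<subseteq> mspace CS1"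
    using A by (auto simp: Beq)
  have BS: "?B \<subseteq> self_adjoints (invertibles (mspace CS1))"
    using invertibles_mono[OF A] by (auto simp: self_adjoints_def)
  have r: "?r s \<in> ?B" if "s \<in> {-1, 1}" for s
    using const that by (auto simp: Beq)
  have r': "function_sign (?r s) = s" if "s \<in> {-1, 1}" for s
  proof -
    have "sgn (Re (?r s 1)) = function_sign (?r s)"
      by (rule sgn_eq_function_sign[OF subsetD[OF BS r[OF that]]]) simp
    moreover have "sgn (Re (?r s 1)) = s"
      using that by (auto simp: sgn_if)
    ultimately show ?thesis
      by simp
  qed
  have rep: "path_component_of (norm_topology_on ?B) a (?r (function_sign a)) \<and> function_sign a \<in> {-1, 1}"
    if a: "a \<in> ?B" for a
  proof
    define s where "s = function_sign a"
    have sgn: "sgn (Re (a z)) = s" if "z \<in> S1" for z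
      using sgn_eq_function_sign[of a z] a BS that unfolding s_def by auto
    have re: "a z = of_real (Re (a z))" "Re (a z) \<noteq> 0" if "z \<in> S1" for z
      using a that unfolding Beq by (auto simp: complex_eq_iff)
    have s: "s \<in> {-1, 1}"
      using re(2)[of 1] sgn[of 1] by (auto simp: sgn_if split: if_splits)
    then show "function_sign a \<in> {-1, 1}"
      by (simp add: s_def)
    \<comment> \<open>The segment from \<open>a\<close> to the constant \<open>s\<close>. On the
      circle both ends are real of the same sign, so it never meets 0 and stays
      self-adjoint.\<close>
    define h where "h t z = of_real (1 - t) * a z + of_real t * ?r s z" for t :: real and z
    have "path_component_of (norm_topology_on ?B) (restrict (h 0) S1) (restrict (h 1) S1)"
    proof (rule path_component_of_homotopy[OF BM])
      have "continuous_on S1 a"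
        using a BM by (auto simp: mspace_CS1)
      then have "continuous_on ({0..1} \<times> S1) (\<lambda>p. a (snd p))"
        by (rule continuous_on_compose2) (auto intro!: continuous_intros)
      then have "continuous_on ({0..1} \<times> S1)
          (\<lambda>p. of_real (1 - fst p) * a (snd p) + of_real (fst p) * of_real s)"
        by (intro continuous_intros)
      then show "continuous_on ({0..1} \<times> S1) (\<lambda>(t, z). h t z)"
        by (rule continuous_on_eq) (auto simp: h_def)
      fix t :: real assume t: "t \<in> {0..1}"
      have "restrict (h t) S1 \<in> A"
        unfolding h_def using a r[OF s] self_adjoints_subset invertibles_subset by (intro segment) blast+
      moreover have "h t z \<noteq> 0 \<and> cnj (h t z) = h t z" if z: "z \<in> S1" for z
      proof -
        have "h t z = of_real ((1 - t) * Re (a z) + t * s)"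
          using re(1)[OF z] z by (simp add: h_def)
        moreover have "sgn s = sgn (Re (a z))"
          using s unfolding sgn[OF z] by auto
        then have "(1 - t) * Re (a z) + t * s \<noteq> 0"
          by (intro convex_combination_nonzero re(2) z t)
        ultimately show ?thesis
          by (metis complex_cnj_complex_of_real of_real_eq_0_iff)
      qed
      ultimately show "restrict (h t) S1 \<in> ?B"
        by (simp add: Beq)
    qed
    \<comment> \<open>Equality also holds off the circle, since elements of
      \<open>mspace CS1\<close> are extensional.\<close>
    moreover have "restrict (h 0) S1 = a"
      using a BM by (auto simp: h_def fun_eq_iff mspace_CS1 extensional_def)
    moreover have "restrict (h 1) S1 = ?r s"
      by (auto simp: h_def fun_eq_iff)
    ultimately show "path_component_of (norm_topology_on ?B) a (?r (function_sign a))"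
      by (simp add: s_def)
  qed
  have inv: "function_sign a = function_sign b"
    if "path_component_of (norm_topology_on ?B) a b" for a b
  proof (rule locally_constant_imp_path_component_invariant[OF _ _ that])
    show "?B \<subseteq> invertibles (mspace CS1)"
      using BS self_adjoints_subset by blast
    show "function_sign a = function_sign b"
      if "a \<in> ?B" "b \<in> ?B" "\<And>z. z \<in> S1 \<Longrightarrow> norm (b z - a z) < norm (a z)" for a b
      using that BS by (intro function_sign_near) auto
  qed
  show ?thesis
    using inv
  proof (rule induces_bij_on_pi0_representatives[where r = ?r])
    show "\<exists>s\<in>{-1, 1}. path_component_of (norm_topology_on ?B) a (?r s)"
      if "a \<in> topspace (norm_topology_on ?B)" for a
      using rep that unfolding topspace_norm_topology_on[OF BM] by blast
  qed (use r r' in \<open>simp_all only: topspace_norm_topology_on[OF BM]\<close>)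
qed

section \<open>The winding number on invertible continuous functions\<close>

lemma circlepath_in_S1: "circlepath 0 1 t \<in> S1"
  by (simp add: circlepath)

lemma loop_on_S1:
  assumes a: "a \<in> invertibles (mspace CS1)"
  shows "path (a \<circ> circlepath 0 1)"
    and "pathfinish (a \<circ> circlepath 0 1) = pathstart (a \<circ> circlepath 0 1)"
    and "0 \<notin> path_image (a \<circ> circlepath 0 1)"
proof -
  have a': "continuous_on S1 a" "\<And>z. z \<in> S1 \<Longrightarrow> a z \<noteq> 0"
    using a unfolding invertibles_iff[OF subset_refl] by (auto simp: mspace_CS1)
  then show "path (a \<circ> circlepath 0 1)"
    by (intro path_continuous_image) auto
  show "pathfinish (a \<circ> circlepath 0 1) = pathstart (a \<circ> circlepath 0 1)"
    by (simp add: pathfinish_compose pathstart_compose)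
  show "0 \<notin> path_image (a \<circ> circlepath 0 1)"
    using a'(2) by (force simp: path_image_compose)
qed

text \<open>The straight-line homotopy between the two loops avoids 0, because the displacement is
  always smaller than the distance of \<open>a z\<close> from 0.\<close>

lemma winding_about_0_near:
  assumes a: "a \<in> invertibles (mspace CS1)" and b: "b \<in> invertibles (mspace CS1)"
    and near: "\<And>z. z \<in> S1 \<Longrightarrow> norm (b z - a z) < norm (a z)"
  shows "winding_about_0 a = winding_about_0 b"
  unfolding winding_about_0_def
  by (intro winding_number_homotopic_loops homotopic_loops_nearby_explicit loop_on_S1 a b)
    (use near circlepath_in_S1 in auto)

text \<open>The loop is the exponential of the segment from 0 to \<open>2 * pi * \<i> * n\<close>,
  so its winding number is the difference of the endpoints divided by
  \<open>2 * pi * \<i>\<close>.\<close>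

lemma winding_about_0_powi:
  "winding_about_0 (restrict (\<lambda>z. z powi n) S1) = of_int n"
proof -
  have "restrict (\<lambda>z. z powi n) S1 \<circ> circlepath 0 1 = exp \<circ> linepath 0 (of_int n * (2 * of_real pi * \<i>))"
  proof
    fix t :: real
    have "restrict (\<lambda>z. z powi n) S1 (circlepath 0 1 t) = circlepath 0 1 t powi n"
      using circlepath_in_S1 by simp
    also have "\<dots> = exp (of_int n * (2 * of_real pi * \<i> * of_real t))"
      by (simp add: circlepath exp_power_int)
    finally show "(restrict (\<lambda>z. z powi n) S1 \<circ> circlepath 0 1) t =
        (exp \<circ> linepath 0 (of_int n * (2 * of_real pi * \<i>))) t"
      by (simp add: linepath_def scaleR_conv_of_real mult_ac)
  qed
  then show ?thesis
    unfolding winding_about_0_def by (simp add: winding_number_compose_exp)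
qed

lemma powi_in_invertibles: "restrict (\<lambda>z. z powi n) S1 \<in> invertibles (mspace CS1)"
proof -
  have "continuous_on S1 (\<lambda>z. z powi n)"
    by (auto intro!: continuous_intros)
  then have "continuous_on S1 (restrict (\<lambda>z. z powi n) S1)"
    by (rule continuous_on_eq) simp
  then show ?thesis
    unfolding invertibles_iff[OF subset_refl] by (auto simp: mspace_CS1)
qed

lemma circlepath_Arg2pi:
  assumes "z \<in> S1"
  shows "circlepath 0 1 (Arg2pi z / (2 * pi)) = z"
  using assms Arg2pi_eq[of z] by (simp add: circlepath mult_ac)

text \<open>The winding number is a complete invariant of loops in the punctured plane. A homotopy
  through loops descends from the interval to the circle and then becomes a path of invertible
  functions.\<close>

lemma path_component_of_winding_about_0_eq:
  assumes a: "a \<in> invertibles (mspace CS1)" and b: "b \<in> invertibles (mspace CS1)"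
    and eq: "winding_about_0 a = winding_about_0 b"
  shows "path_component_of (norm_topology_on (invertibles (mspace CS1))) a b"
proof -
  let ?B = "invertibles (mspace CS1)"
  have "homotopic_loops (-{0}) (a \<circ> circlepath 0 1) (b \<circ> circlepath 0 1)"
    using eq unfolding winding_about_0_def
    by (subst (asm) winding_number_homotopic_loops_eq) (use loop_on_S1 a b in auto)
  \<comment> \<open>The resulting circle maps are the loops precomposed with
    \<open>Arg2pi z / (2 * pi)\<close>; \<open>circlepath_Arg2pi\<close> identifies them with
    \<open>a\<close> and \<open>b\<close> on the circle.\<close>
  from homotopic_loops_imp_homotopic_circlemaps[OF this]
  obtain h :: "real \<times> complex \<Rightarrow> complex" where cont: "continuous_on ({0..1} \<times> S1) h"
    and nz: "h \<in> {0..1} \<times> S1 \<rightarrow> -{0}"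
    and h0: "\<And>z. z \<in> S1 \<Longrightarrow> h (0, z) = a z" and h1: "\<And>z. z \<in> S1 \<Longrightarrow> h (1, z) = b z"
    using circlepath_Arg2pi by (fastforce simp: homotopic_with_def)
  have "path_component_of (norm_topology_on ?B)
      (restrict (\<lambda>z. h (0, z)) S1) (restrict (\<lambda>z. h (1, z)) S1)"
  proof (rule path_component_of_homotopy[of _ "\<lambda>t z. h (t, z)"])
    show "?B \<subseteq> mspace CS1" by (rule invertibles_subset)
    show "continuous_on ({0..1} \<times> S1) (\<lambda>(t, z). h (t, z))"
      using cont by (simp add: case_prod_eta)
    fix t :: real assume t: "t \<in> {0..1}"
    have "continuous_on S1 (\<lambda>z. h (t, z))"
      using t by (intro continuous_on_compose2[OF cont]) (auto intro!: continuous_intros)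
    then have "continuous_on S1 (restrict (\<lambda>z. h (t, z)) S1)"
      by (rule continuous_on_eq) simp
    then show "restrict (\<lambda>z. h (t, z)) S1 \<in> ?B"
      using nz t unfolding invertibles_iff[OF subset_refl] by (force simp: mspace_CS1)
  qed
  moreover have "restrict (\<lambda>z. h (0, z)) S1 = a" "restrict (\<lambda>z. h (1, z)) S1 = b"
    using a b invertibles_subset[of "mspace CS1"] h0 h1
    by (auto simp: fun_eq_iff mspace_CS1 extensional_def)
  ultimately show ?thesis by simp
qed

section \<open>Factorization and deformation of elements of \<open>FR\<close>\<close>

text \<open>Splits the polynomial with coefficients \<open>a\<close>, \<open>b\<close>,
  \<open>c\<close> in increasing degree into two factors of degree at most one, with vanishing
  leading coefficients allowed.\<close>

lemma quadratic_factorization: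
  fixes a b c :: complex
  obtains \<alpha> \<beta> \<gamma> \<delta> where "a = \<alpha> * \<gamma>" "b = \<alpha> * \<delta> + \<beta> * \<gamma>" "c = \<beta> * \<delta>"
proof (cases "c = 0")
  case True
  then show ?thesis
    using that[of a 1 0 b] by simp
next
  case False
  define s where "s = csqrt (b\<^sup>2 - 4 * a * c)"
  have s: "s * s = b * b - 4 * a * c"
    unfolding s_def by (metis power2_csqrt power2_eq_square)
  \<comment> \<open>The quadratic formula: the factors are \<open>(b - s) / 2 + c * z\<close> and
    \<open>(b + s) / (2 * c) + z\<close>. The instantiation follows the order of occurrence
    \<alpha>, \<gamma>, \<delta>, \<beta>.\<close>
  show ?thesis
  proof (rule that[of "(b - s) / 2" "(b + s) / (2 * c)" 1 c])
    show "a = (b - s) / 2 * ((b + s) / (2 * c))"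
      using False s by (simp add: field_simps)
    show "b = (b - s) / 2 * 1 + c * ((b + s) / (2 * c))"
      using False by (simp add: field_simps)
  qed simp
qed

text \<open>For nonzero \<beta> the only root is \<open>- \<alpha> / \<beta>\<close>, which lies on
  the circle exactly when the moduli agree.\<close>

lemma linear_nonzero_on_S1_iff:
  fixes \<alpha> \<beta> :: complex
  shows "(\<forall>z\<in>S1. \<alpha> + \<beta> * z \<noteq> 0) \<longleftrightarrow> norm \<alpha> \<noteq> norm \<beta>"
proof
  assume nz: "\<forall>z\<in>S1. \<alpha> + \<beta> * z \<noteq> 0"
  show "norm \<alpha> \<noteq> norm \<beta>"
  proof
    assume eq: "norm \<alpha> = norm \<beta>"
    show False
    proof (cases "\<beta> = 0")
      case True
      with eq nz[rule_format, of 1] show False by simp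
    next
      case False
      with eq nz[rule_format, of "- \<alpha> / \<beta>"] show False
        by (simp add: norm_divide)
    qed
  qed
next
  assume ne: "norm \<alpha> \<noteq> norm \<beta>"
  show "\<forall>z\<in>S1. \<alpha> + \<beta> * z \<noteq> 0"
  proof
    fix z :: complex assume z: "z \<in> S1"
    show "\<alpha> + \<beta> * z \<noteq> 0"
    proof
      assume "\<alpha> + \<beta> * z = 0"
      then have "norm \<alpha> = norm (\<beta> * z)"
        by (metis add_eq_0_iff2 norm_minus_cancel)
      with z ne show False by (simp add: norm_mult)
    qed
  qed
qed

lemma linear_factor_deformation_aux:
  fixes \<alpha> \<beta> :: complex
  assumes "norm \<beta> < norm \<alpha>"
  obtains A B :: "real \<Rightarrow> complex" where "continuous_on {0..1} A" "continuous_on {0..1} B"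
    "\<forall>t\<in>{0..1}. norm (B t) < norm (A t)" "A 0 = \<alpha>" "B 0 = \<beta>" "A 1 = 1" "B 1 = 0"
proof -
  have \<alpha>: "\<alpha> \<noteq> 0" using assms by auto
  \<comment> \<open>A straight segment from \<alpha> to 1 could pass through 0; scaling the
    logarithm cannot.\<close>
  define A :: "real \<Rightarrow> complex" where "A t = exp (of_real (1 - t) * Ln \<alpha>)" for t
  \<comment> \<open>The ratio of \<open>B t\<close> to \<open>A t\<close> is
    \<open>\<beta> / \<alpha>\<close> scaled down by \<open>1 - t\<close>, so its modulus stays
    below 1.\<close>
  define B where "B t = of_real (1 - t) * (\<beta> / \<alpha>) * A t" for t
  have "norm (B t) < norm (A t)" if t: "t \<in> {0..1}" for t
  proof -
    have "(1 - t) * norm (\<beta> / \<alpha>) \<le> norm (\<beta> / \<alpha>)"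
      using t by (intro mult_left_le_one_le) auto
    also have "\<dots> < 1"
      using assms \<alpha> by (simp add: norm_divide)
    finally have "norm (of_real (1 - t) * (\<beta> / \<alpha>)) < 1"
      using t by (simp only: norm_mult norm_of_real) simp
    moreover have "norm (A t) > 0"
      by (simp add: A_def)
    ultimately show ?thesis
      unfolding B_def norm_mult[of _ "A t"] by (metis mult_less_cancel_right_disj mult_1)
  qed
  moreover have "continuous_on {0..1} A" "continuous_on {0..1} B"
    unfolding A_def B_def by (intro continuous_intros)+
  moreover have "A 0 = \<alpha>" "B 0 = \<beta>" "A 1 = 1" "B 1 = 0"
    using \<alpha> by (auto simp: A_def B_def)
  ultimately show ?thesis
    using that by blast
qed

text \<open>The larger coefficient goes to 1 and the smaller to 0; if \<beta> dominates, the
  auxiliary deformation is used with the roles exchanged.\<close>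

lemma linear_factor_deformation:
  fixes \<alpha> \<beta> :: complex
  assumes "norm \<alpha> \<noteq> norm \<beta>"
  obtains A B :: "real \<Rightarrow> complex" where "continuous_on {0..1} A" "continuous_on {0..1} B"
    "\<forall>t\<in>{0..1}. norm (A t) \<noteq> norm (B t)" "A 0 = \<alpha>" "B 0 = \<beta>"
    "A 1 = 1 \<and> B 1 = 0 \<or> A 1 = 0 \<and> B 1 = 1"
proof (cases "norm \<beta> < norm \<alpha>")
  case True
  then show ?thesis
    using linear_factor_deformation_aux[of \<beta> \<alpha>] that by (metis less_irrefl)
next
  case False
  with assms have "norm \<alpha> < norm \<beta>" by simp
  then show ?thesis
    using linear_factor_deformation_aux[of \<alpha> \<beta>] that by (metis less_irrefl)
qed

lemma cnj_eq_inverse_on_S1: "z \<in> S1 \<Longrightarrow> cnj z = inverse z"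
  by (intro inverse_unique[symmetric]) (simp add: complex_norm_square[symmetric])

lemma FR_factor:
  fixes z :: complex
  assumes "z \<in> S1"
  shows "(\<alpha> * \<gamma>) * cnj z + (\<alpha> * \<delta> + \<beta> * \<gamma>) + (\<beta> * \<delta>) * z = cnj z * ((\<alpha> + \<beta> * z) * (\<gamma> + \<delta> * z))"
proof -
  have "z * cnj z = 1"
    using assms by (simp add: complex_norm_square[symmetric])
  then show ?thesis
    by algebra
qed

text \<open>Bounds the number of components by three: the prefix \<open>cnj z\<close> contributes -1
  to the exponent, and each of the two linear factors contributes 0 or 1.\<close>

lemma path_component_of_FR_powi:
  assumes a: "a \<in> invertibles FR"
  shows "\<exists>n\<in>{-1, 0, 1}. path_component_of (norm_topology_on (invertibles FR)) a
    (restrict (\<lambda>z. z powi n) S1)"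
proof -
  let ?B = "invertibles FR"
  note Beq = invertibles_iff[OF FR_subset_CS1]
  obtain a' a0 a1 where aeq: "a = restrict (\<lambda>z. a' * cnj z + a0 + a1 * z) S1"
    using a invertibles_subset[of FR] by (auto simp: FR_def)
  obtain \<alpha> \<beta> \<gamma> \<delta> where fac: "a' = \<alpha> * \<gamma>" "a0 = \<alpha> * \<delta> + \<beta> * \<gamma>" "a1 = \<beta> * \<delta>"
    using quadratic_factorization .
  have az: "a z = cnj z * ((\<alpha> + \<beta> * z) * (\<gamma> + \<delta> * z))" if "z \<in> S1" for z
    using that FR_factor[OF that] by (simp add: aeq fac)
  then have "\<forall>z\<in>S1. \<alpha> + \<beta> * z \<noteq> 0" "\<forall>z\<in>S1. \<gamma> + \<delta> * z \<noteq> 0"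
    using a unfolding Beq by fastforce+
  then have ne: "norm \<alpha> \<noteq> norm \<beta>" "norm \<gamma> \<noteq> norm \<delta>"
    by (simp_all only: linear_nonzero_on_S1_iff) simp_all
  obtain A B :: "real \<Rightarrow> complex" where AB: "continuous_on {0..1} A" "continuous_on {0..1} B"
    "\<forall>t\<in>{0..1}. norm (A t) \<noteq> norm (B t)" "A 0 = \<alpha>" "B 0 = \<beta>"
    and AB1: "A 1 = 1 \<and> B 1 = 0 \<or> A 1 = 0 \<and> B 1 = 1"
    using linear_factor_deformation[OF ne(1)] .
  obtain C D :: "real \<Rightarrow> complex" where CD: "continuous_on {0..1} C" "continuous_on {0..1} D"
    "\<forall>t\<in>{0..1}. norm (C t) \<noteq> norm (D t)" "C 0 = \<gamma>" "D 0 = \<delta>"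
    and CD1: "C 1 = 1 \<and> D 1 = 0 \<or> C 1 = 0 \<and> D 1 = 1"
    using linear_factor_deformation[OF ne(2)] .
  \<comment> \<open>The expanded form shows that every stage lies in \<open>FR\<close>; the factored
    form below shows that it has no zero on the circle.\<close>
  define h where "h t z = (A t * C t) * cnj z + (A t * D t + B t * C t) + (B t * D t) * z" for t z
  have h: "h t z = cnj z * ((A t + B t * z) * (C t + D t * z))" if "z \<in> S1" for t z
    unfolding h_def using FR_factor[OF that] .
  have "path_component_of (norm_topology_on ?B) (restrict (h 0) S1) (restrict (h 1) S1)"
  proof (rule path_component_of_homotopy)
    show "?B \<subseteq> mspace CS1"
      using invertibles_subset FR_subset_CS1 by blast
    have fst: "continuous_on ({0..1} \<times> S1) (\<lambda>p. F (fst p))" if "continuous_on {0..1} F"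
      for F :: "real \<Rightarrow> complex"
      using that by (rule continuous_on_compose2) (auto intro!: continuous_intros)
    show "continuous_on ({0..1} \<times> S1) (\<lambda>(t, z). h t z)"
      unfolding h_def case_prod_unfold
      by (intro continuous_intros fst AB CD)
    fix t :: real assume t: "t \<in> {0..1}"
    have "restrict (h t) S1 \<in> FR"
      unfolding FR_def h_def by blast
    moreover have "h t z \<noteq> 0" if z: "z \<in> S1" for z
    proof -
      have "A t + B t * z \<noteq> 0" "C t + D t * z \<noteq> 0"
        using bspec[OF AB(3) t] bspec[OF CD(3) t] z linear_nonzero_on_S1_iff by blast+
      with z show ?thesis
        by (auto simp: h)
    qed
    ultimately show "restrict (h t) S1 \<in> ?B"
      unfolding Beq by simp
  qed
  moreover have "restrict (h 0) S1 = a"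
    using AB CD by (simp add: aeq h_def fac fun_eq_iff)
  \<comment> \<open>The exponent is -1 plus the number of factors deformed to \<open>z\<close>; the
    two mixed cases both give the constant 1.\<close>
  moreover have "\<exists>n\<in>{-1, 0, 1}. restrict (h 1) S1 = restrict (\<lambda>z. z powi n) S1"
    using AB1 CD1 by (auto simp: h_def cnj_eq_inverse_on_S1 fun_eq_iff power_int_minus restrict_def)
  ultimately show ?thesis by auto
qed

lemma powi_in_FR:
  assumes "n \<in> {-1, 0, 1}"
  shows "restrict (\<lambda>z. z powi n) S1 \<in> invertibles FR"
proof -
  \<comment> \<open>The indicator coefficients put all three powers in the shape required by
    \<open>FR\<close> at once.\<close>
  have "restrict (\<lambda>z. z powi n) S1 = restrict (\<lambda>z. of_bool (n = -1) * cnj z +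
      of_bool (n = 0) + of_bool (n = 1) * z) S1"
    using assms by (auto simp: fun_eq_iff power_int_minus cnj_eq_inverse_on_S1)
  then have "restrict (\<lambda>z. z powi n) S1 \<in> FR"
    unfolding FR_def by blast
  then show ?thesis
    unfolding invertibles_iff[OF FR_subset_CS1] by auto
qed

section \<open>Bijections induced by the winding number, and conclusion\<close>

lemma induces_bij_on_pi0_winding_about_0:
  assumes A: "A \<subseteq> invertibles (mspace CS1)"
    and powi: "\<And>n. n \<in> N \<Longrightarrow> restrict (\<lambda>z. z powi n) S1 \<in> A"
    and rep: "\<And>a. a \<in> A \<Longrightarrow>
      \<exists>n\<in>N. path_component_of (norm_topology_on A) a (restrict (\<lambda>z. z powi n) S1)"
  shows "induces_bij_on_pi0 winding_about_0 (norm_topology_on A) (of_int ` N)"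
proof -
  have AM: "A \<subseteq> mspace CS1"
    using A invertibles_subset by blast
  have "winding_about_0 a = winding_about_0 b" if "path_component_of (norm_topology_on A) a b" for a b
    using A _ that by (rule locally_constant_imp_path_component_invariant)
      (use A in \<open>auto intro: winding_about_0_near\<close>)
  then show ?thesis
    using powi rep
    \<comment> \<open>Values of the winding number are complex, so
      \<open>\<lfloor>Re w\<rfloor>\<close> recovers the integer exponent from
      \<open>w\<close>.\<close>
    by (intro induces_bij_on_pi0_representatives[where r = "\<lambda>w. restrict (\<lambda>z. z powi \<lfloor>Re w\<rfloor>) S1"])
      (auto simp: topspace_norm_topology_on[OF AM] winding_about_0_powi)
qed

theorem mainTheorem3:
  shows "(induces_bij_on_pi0 function_sign
            (norm_topology_on (self_adjoints (invertibles FR))) {-1, 1} \<and>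
          induces_bij_on_pi0 function_sign
            (norm_topology_on (self_adjoints (invertibles (mspace CS1)))) {-1, 1}) \<and>
         (induces_bij_on_pi0 winding_about_0
            (norm_topology_on (invertibles FR)) {-1, 0, 1} \<and>
          induces_bij_on_pi0 winding_about_0
            (norm_topology_on (invertibles (mspace CS1))) \<int>)"
proof (intro conjI)
  show "induces_bij_on_pi0 function_sign
      (norm_topology_on (self_adjoints (invertibles FR))) {-1, 1}"
    by (intro induces_bij_on_pi0_function_sign FR_subset_CS1 const_in_FR FR_segment)
  show "induces_bij_on_pi0 function_sign
      (norm_topology_on (self_adjoints (invertibles (mspace CS1)))) {-1, 1}"
    using const_in_FR FR_subset_CS1
    by (intro induces_bij_on_pi0_function_sign mspace_CS1_segment) auto
  show "induces_bij_on_pi0 winding_about_0 (norm_topology_on (invertibles FR)) {-1, 0, 1}"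
    using induces_bij_on_pi0_winding_about_0[OF invertibles_mono[OF FR_subset_CS1]
        powi_in_FR path_component_of_FR_powi]
    by simp
  \<comment> \<open>Among all continuous functions every exponent is available as a model; the one
    for \<open>a\<close> is its winding number, an integer because the loop is closed.\<close>
  have "\<exists>n\<in>UNIV. path_component_of (norm_topology_on (invertibles (mspace CS1))) a
      (restrict (\<lambda>z. z powi n) S1)" if a: "a \<in> invertibles (mspace CS1)" for a
  proof -
    have "winding_about_0 a \<in> \<int>"
      unfolding winding_about_0_def by (intro integer_winding_number loop_on_S1 a)
    then obtain n where "winding_about_0 a = of_int n"
      by (elim Ints_cases)
    then show ?thesis
      using path_component_of_winding_about_0_eq[OF a powi_in_invertibles]
      by (metis UNIV_I winding_about_0_powi)
  qed
  then show "induces_bij_on_pi0 winding_about_0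
      (norm_topology_on (invertibles (mspace CS1))) \<int>"
    unfolding Ints_def
    by (intro induces_bij_on_pi0_winding_about_0 powi_in_invertibles subset_refl)
qed

end
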